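(* Let $p\in(1,\infty)$, $r\in[2,\infty)$, let $K:\mathbb{R}^N\times\mathbb{R}^N\to\mathbb{R}_+$ be a positive kernel and let $\mathcal{E}$ be the energy $$\mathcal{E}(u,v)=\int_{\mathbb{R}^N}\int_{\mathbb{R}^N}|u(x)-u(y)|^{p-2}(u(x)-u(y))(v(x)-v(y))K(x,y)\,dxdy.$$ Then $$C_{r,p}\,\mathcal{E}\left(|u|^{\frac{r-2}{p}}u,\,|u|^{\frac{r-2}{p}}u\right)\le\mathcal{E}\left(u,\,|u|^{r-2}u\right)$$ for all functions $u:\mathbb{R}^N\to\mathbb{R}$ for which both terms in this inequality make sense, where $$C_{r,p}:=(r-1)\left(\frac{p}{p+r-2}\right)^p.$$
   Context: Kernel and functions are (Lebesgue) measurable. The expression $|a|^{p-2}a$ is understood as $0$ when $a=0$. *)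

theory Defs
  imports "HOL-Analysis.Analysis"
begin

text \<open>\<open>0 powr s = 0\<close> for every \<open>s\<close>, so \<open>\<bar>a\<bar> powr s * a\<close> is \<open>0\<close> at \<open>a = 0\<close>, also for
  negative or zero exponents.\<close>

definition spow :: "real \<Rightarrow> real \<Rightarrow> real" where
  "spow s a = \<bar>a\<bar> powr s * a"

definition energy_density ::
  "real \<Rightarrow> (real ^ 'n \<Rightarrow> real ^ 'n \<Rightarrow> real) \<Rightarrow> (real ^ 'n \<Rightarrow> real) \<Rightarrow> (real ^ 'n \<Rightarrow> real)
    \<Rightarrow> (real ^ 'n) \<times> (real ^ 'n) \<Rightarrow> real" where
  "energy_density p K u v = (\<lambda>(x, y). spow (p - 2) (u x - u y) * (v x - v y) * K x y)"

text \<open>The double integral is the Lebesgue integral over the product space, with values in the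
  extended reals: integral of the positive part minus integral of the negative part
  (\<open>ennreal\<close> sends negative reals to \<open>0\<close>). It makes sense when the integrand is measurable and
  these two are not both infinite. Infinite values of the energy are allowed.\<close>

definition energy_defined ::
  "real \<Rightarrow> (real ^ 'n \<Rightarrow> real ^ 'n \<Rightarrow> real) \<Rightarrow> (real ^ 'n \<Rightarrow> real) \<Rightarrow> (real ^ 'n \<Rightarrow> real) \<Rightarrow> bool" where
  "energy_defined p K u v \<longleftrightarrow>
     energy_density p K u v \<in> borel_measurable lebesgue \<and>
     ((\<integral>\<^sup>+ z. ennreal (energy_density p K u v z) \<partial>lebesgue) < \<infinity> \<or>
      (\<integral>\<^sup>+ z. ennreal (- energy_density p K u v z) \<partial>lebesgue) < \<infinity>)"

definition energy ::
  "real \<Rightarrow> (real ^ 'n \<Rightarrow> real ^ 'n \<Rightarrow> real) \<Rightarrow> (real ^ 'n \<Rightarrow> real) \<Rightarrow> (real ^ 'n \<Rightarrow> real) \<Rightarrow> ereal" where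
  "energy p K u v =
     enn2ereal (\<integral>\<^sup>+ z. ennreal (energy_density p K u v z) \<partial>lebesgue)
     - enn2ereal (\<integral>\<^sup>+ z. ennreal (- energy_density p K u v z) \<partial>lebesgue)"

definition C_const :: "real \<Rightarrow> real \<Rightarrow> real" where
  "C_const r p = (r - 1) * (p / (p + r - 2)) powr p"

end

theory Submission imports Defs begin

text \<open>The inequality holds pointwise between the two integrands. For \<open>b < a\<close> it follows from Jensen's
  inequality applied to \<open>\<phi> a - \<phi> b = \<integral> \<phi>'\<close> on \<open>[b, a]\<close>, where \<open>\<phi> t = \<bar>t\<bar> powr s * t\<close> and
  \<open>s = (r - 2) / p\<close>, because \<open>(\<phi>' t) powr p\<close> is a constant multiple of the derivative of
  \<open>\<bar>t\<bar> powr (r - 2) * t\<close>. The tangent form of Jensen's inequality makes the integral unnecessary: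
  Young's inequality with a parameter \<open>m\<close> says that a combination of the functions is monotone, and
  \<open>m\<close> is then chosen as the mean value of \<open>\<bar>t\<bar> powr s\<close> on \<open>[b, a]\<close>.\<close>

lemma spow_zero_exponent [simp]: "spow 0 = id"
  by (auto simp: spow_def fun_eq_iff)

lemma spow_minus: "spow s (- a) = - spow s a"
  by (simp add: spow_def)

lemma spow_minus_two_mult_self: "spow (p - 2) a * a = \<bar>a\<bar> powr p"
proof (cases "a = 0")
  case False
  then show ?thesis
    by (simp add: spow_def powr_diff power2_eq_square)
qed (simp add: spow_def)

text \<open>Away from 0 this is the power rule, carried to negative \<open>t\<close> by oddness. At
  0 the difference quotient is \<open>|h| powr s\<close>, which tends to 0 because \<open>s\<close>
  is positive.\<close>

lemma has_real_derivative_spow: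
  assumes "0 < s"
  shows "(spow s has_real_derivative (s + 1) * \<bar>t\<bar> powr s) (at t)"
proof -
  have pos: "(spow s has_real_derivative (s + 1) * x powr s) (at x)" if "0 < x" for x
  proof -
    have "((\<lambda>y. y powr (s + 1)) has_real_derivative (s + 1) * x powr s) (at x)"
      using that by (auto intro!: derivative_eq_intros)
    then show ?thesis
      by (rule has_field_derivative_transform_within_open[where S = "{0<..}"])
        (use that in \<open>auto simp: spow_def powr_add\<close>)
  qed
  consider "0 < t" | "t < 0" | "t = 0" by linarith
  then show ?thesis
  proof cases
    case 1
    then show ?thesis using pos by simp
  next
    case 2
    then have "((\<lambda>y. - spow s (- y)) has_real_derivative (s + 1) * \<bar>t\<bar> powr s) (at t)"
      using pos[of "- t"] by (auto intro!: derivative_eq_intros DERIV_chain2[of "spow s"])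
    then show ?thesis by (simp add: spow_minus)
  next
    case 3
    have "((\<lambda>h. \<bar>h\<bar> powr s) \<longlongrightarrow> 0) (at (0::real))"
      using assms by (auto intro!: tendsto_eq_intros)
    then have "((\<lambda>h. spow s h / h) \<longlongrightarrow> 0) (at 0)"
      by (rule Lim_transform_eventually) (auto simp: spow_def eventually_at_filter)
    then show ?thesis
      using 3 by (simp add: DERIV_def spow_def)
  qed
qed

lemma spow_mono:
  assumes "0 < s" "a \<le> b"
  shows "spow s a \<le> spow s b"
  using assms(2) by (rule DERIV_nonneg_imp_nondecreasing)
    (use has_real_derivative_spow[OF assms(1)] assms(1) in \<open>auto intro!: exI\<close>)

text \<open>As a function of \<open>x powr p\<close>, the left side is concave; the right side is
  its tangent at \<open>x = m\<close>. The proof is Young's inequality for \<open>x / m\<close> and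
  1, scaled by \<open>m\<close>.\<close>

lemma Young_powr_tangent:
  fixes x m p :: real
  assumes "1 < p" "0 \<le> x" "0 < m"
  shows "x \<le> x powr p / (p * m powr (p - 1)) + (1 - 1 / p) * m"
proof -
  have "x / m \<le> (x / m) powr p / p + (1 - 1 / p)"
    using Youngs_inequality[of p "p / (p - 1)" "x / m" 1] assms
    by (simp add: diff_divide_distrib add_divide_distrib)
  then have "x / m * m \<le> ((x / m) powr p / p + (1 - 1 / p)) * m"
    using assms by (intro mult_right_mono) auto
  also have "\<dots> = (x / m) powr p * m / p + (1 - 1 / p) * m"
    by (simp add: algebra_simps)
  also have "(x / m) powr p * m = x powr p / m powr (p - 1)"
    using assms by (simp add: powr_divide powr_diff)
  finally show ?thesis
    using assms by (simp add: mult.commute)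
qed

text \<open>The exponent \<open>q / p\<close> is chosen so that the \<open>p\<close>-th power of
  \<open>|t| powr (q / p)\<close> is \<open>|t| powr q\<close>, whose antiderivative is
  \<open>spow q t / (q + 1)\<close>.\<close>

lemma spow_diff_powr_le_less:
  fixes p q a b :: real
  assumes p: "1 < p" and q: "0 < q" and "b < a"
  shows "(q + 1) * (spow (q / p) a - spow (q / p) b) powr p
    \<le> (q / p + 1) powr p * (a - b) powr (p - 1) * (spow q a - spow q b)"
proof -
  define s where "s = q / p"
  define d where "d = a - b"
  define D where "D = spow s a - spow s b"
  define P where "P = spow q a - spow q b"
  have s: "0 < s" and d: "0 < d"
    using assms by (auto simp: s_def d_def)
  have "0 \<le> D" "0 \<le> P"
    using spow_mono[OF s, of b a] spow_mono[OF q, of b a] \<open>b < a\<close> by (auto simp: D_def P_def)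
  have "(q + 1) * D powr p \<le> (s + 1) powr p * d powr (p - 1) * P"
  \<comment> \<open>For \<open>D = 0\<close> the mean value \<open>m\<close> would vanish, whereas
    the tangent inequality needs \<open>m\<close> positive.\<close>
  proof (cases "D = 0")
    case True
    then show ?thesis
      using \<open>0 \<le> P\<close> by simp
  next
    case False
    then have D: "0 < D"
      using \<open>0 \<le> D\<close> by simp
    define m where "m = D / ((s + 1) * d)"
    have m: "0 < m"
      using D s d by (simp add: m_def)
    \<comment> \<open>\<open>G\<close> is an antiderivative of \<open>s + 1\<close> times the gap in
      the tangent inequality at \<open>x = |t| powr s\<close>, hence nondecreasing.\<close>
    define G where "G = (\<lambda>t. (s + 1) *
      (spow q t / (q + 1) / (p * m powr (p - 1)) + (1 - 1 / p) * m * t) - spow s t)"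
    define G' where "G' = (\<lambda>t. (s + 1) *
      (\<bar>t\<bar> powr q / (p * m powr (p - 1)) + (1 - 1 / p) * m - \<bar>t\<bar> powr s))"
    have "(G has_real_derivative G' t) (at t)" for t
    proof -
      have "((\<lambda>t. spow q t / (q + 1)) has_real_derivative \<bar>t\<bar> powr q) (at t)"
        using DERIV_cdivide[OF has_real_derivative_spow[OF q, of t], of "q + 1"] q by simp
      then have "(G has_real_derivative (s + 1) *
          (\<bar>t\<bar> powr q / (p * m powr (p - 1)) + (1 - 1 / p) * m * 1) - (s + 1) * \<bar>t\<bar> powr s) (at t)"
        unfolding G_def
        by (intro DERIV_diff DERIV_cmult DERIV_add DERIV_cdivide DERIV_ident
            has_real_derivative_spow s)
      then show ?thesis
        by (simp add: G'_def algebra_simps)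
    qed
    moreover have "0 \<le> G' t" for t
    proof -
      have "(\<bar>t\<bar> powr s) powr p = \<bar>t\<bar> powr q"
        using p by (simp add: powr_powr s_def)
      then show ?thesis
        using Young_powr_tangent[OF p _ m, of "\<bar>t\<bar> powr s"] s by (simp add: G'_def)
    qed
    ultimately have "G b \<le> G a"
      using \<open>b < a\<close> by (intro DERIV_nonneg_imp_nondecreasing[of b a G]) auto
    then have "D \<le> (s + 1) * (P / (q + 1) / (p * m powr (p - 1))) + (1 - 1 / p) * (m * ((s + 1) * d))"
      unfolding G_def D_def P_def d_def diff_divide_distrib by argo
    \<comment> \<open>By the choice of \<open>m\<close> the linear term becomes
      \<open>(1 - 1 / p) * D\<close>; moving it to the left leaves \<open>D / p\<close>.\<close>
    also have "m * ((s + 1) * d) = D"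
      using s d by (simp add: m_def)
    finally have "D / p \<le> (s + 1) * P / ((q + 1) * m powr (p - 1)) / p"
      by (simp add: algebra_simps)
    then have "D \<le> (s + 1) * P / ((q + 1) * m powr (p - 1))"
      using p by (subst (asm) divide_le_cancel) auto
    then have *: "(q + 1) * (D * m powr (p - 1)) \<le> (s + 1) * P"
      using q m by (simp add: pos_le_divide_eq mult_ac)
    \<comment> \<open>Writing \<open>D\<close> as \<open>m * (s + 1) * d\<close> in the second
      factor produces the power of \<open>m\<close> that occurs in \<open>*\<close>.\<close>
    have "D powr p = D * D powr (p - 1)"
      using D by (simp add: powr_diff)
    also have "D powr (p - 1) = m powr (p - 1) * ((s + 1) powr (p - 1) * d powr (p - 1))"
      using D s d by (simp add: m_def powr_divide powr_mult)
    finally have "(q + 1) * D powr p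
        = (q + 1) * (D * m powr (p - 1)) * ((s + 1) powr (p - 1) * d powr (p - 1))"
      by simp
    also have "\<dots> \<le> (s + 1) * P * ((s + 1) powr (p - 1) * d powr (p - 1))"
      by (rule mult_right_mono[OF *]) simp
    also have "\<dots> = (s + 1) powr p * d powr (p - 1) * P"
      using s by (simp add: powr_diff)
    finally show ?thesis .
  qed
  then show ?thesis
    by (simp add: s_def d_def D_def P_def)
qed

text \<open>This is the comparison of the integrands before multiplication by the kernel. Both sides
  are symmetric in \<open>a\<close> and \<open>b\<close>, so the case \<open>b < a\<close>
  decides.\<close>

lemma spow_diff_powr_le:
  fixes p r a b :: real
  assumes p: "1 < p" and r: "2 \<le> r"
  shows "C_const r p * \<bar>spow ((r - 2) / p) a - spow ((r - 2) / p) b\<bar> powr p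
    \<le> spow (p - 2) (a - b) * (spow (r - 2) a - spow (r - 2) b)"
\<comment> \<open>At \<open>r = 2\<close> the exponents vanish, the constant is 1 and equality
  holds; the derivative formula covers only positive exponents.\<close>
proof (cases "r = 2")
  case True
  then show ?thesis
    using p by (simp add: C_const_def spow_minus_two_mult_self)
next
  case False
  have less: "C_const r p * \<bar>spow ((r - 2) / p) a - spow ((r - 2) / p) b\<bar> powr p
    \<le> spow (p - 2) (a - b) * (spow (r - 2) a - spow (r - 2) b)" if "b < a" for a b
  proof -
    define q where "q = r - 2"
    have q: "0 < q"
      using r False by (simp add: q_def)
    have s: "0 < q / p"
      using q p by simp
    have mono: "spow (q / p) b \<le> spow (q / p) a"
      using spow_mono[OF s] that by simp
    have "p / (p + q) = 1 / (q / p + 1)"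
      using p by (simp add: field_simps)
    then have C: "C_const r p = (q + 1) / (q / p + 1) powr p"
      using s by (simp add: C_const_def q_def powr_divide add_diff_eq)
    have "(a - b) powr (p - 1) = spow (p - 2) (a - b)"
      using that powr_mult_base[of "a - b" "p - 2"] by (simp add: spow_def mult.commute)
    then show ?thesis
      using spow_diff_powr_le_less[OF p q that] mono s unfolding C
      by (simp add: q_def[symmetric] divide_le_eq mult_ac)
  qed
  consider "b < a" | "a < b" | "a = b" by linarith
  then show ?thesis
  proof cases
    \<comment> \<open>Exchanging \<open>a\<close> and \<open>b\<close> flips the sign of both
      factors on the right.\<close>
    case 2
    then show ?thesis
      using less[OF 2] spow_minus[of "p - 2" "b - a"] by (simp add: abs_minus_commute algebra_simps)
  qed (simp_all add: less)
qed

theorem lemma3p9: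
  fixes p r :: real
    and K :: "real ^ 'n \<Rightarrow> real ^ 'n \<Rightarrow> real"
    and u :: "real ^ 'n \<Rightarrow> real"
  assumes "1 < p"
    and "2 \<le> r"
    and "(\<lambda>(x, y). K x y) \<in> borel_measurable lebesgue"
    and "\<And>x y. 0 \<le> K x y"
    and "u \<in> borel_measurable lebesgue"
    and "energy_defined p K (\<lambda>x. spow ((r - 2) / p) (u x)) (\<lambda>x. spow ((r - 2) / p) (u x))"
    and "energy_defined p K u (\<lambda>x. spow (r - 2) (u x))"
  shows "ereal (C_const r p) *
           energy p K (\<lambda>x. spow ((r - 2) / p) (u x)) (\<lambda>x. spow ((r - 2) / p) (u x))
         \<le> energy p K u (\<lambda>x. spow (r - 2) (u x))"
proof -
  let ?\<phi> = "\<lambda>x. spow ((r - 2) / p) (u x)" and ?\<psi> = "\<lambda>x. spow (r - 2) (u x)"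
  define f where "f = energy_density p K ?\<phi> ?\<phi>"
  define g where "g = energy_density p K u ?\<psi>"
  have C: "0 \<le> C_const r p"
    using assms(2) by (simp add: C_const_def)
  have f_eq: "f (x, y) = \<bar>?\<phi> x - ?\<phi> y\<bar> powr p * K x y" for x y
    by (simp add: f_def energy_density_def spow_minus_two_mult_self)
  have f_nonneg: "0 \<le> f z" for z
    using assms(4) by (cases z) (simp add: f_eq)
  have f_le_g: "C_const r p * f z \<le> g z" for z
  proof (cases z)
    case (Pair x y)
    show ?thesis
      using mult_right_mono[OF spow_diff_powr_le[OF assms(1,2), of "u x" "u y"] assms(4)[of x y]]
      by (simp add: Pair f_eq g_def energy_density_def mult.assoc)
  qed
  \<comment> \<open>With both densities nonnegative, the negative parts integrate to 0, so each
    energy is a single, possibly infinite, nonnegative integral.\<close>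
  have g_nonneg: "0 \<le> g z" for z
    using mult_nonneg_nonneg[OF C f_nonneg] f_le_g by (rule order_trans)
  have [measurable]: "f \<in> borel_measurable lebesgue"
    using assms(6) by (simp add: energy_defined_def f_def)
  have "ennreal (C_const r p) * (\<integral>\<^sup>+ z. ennreal (f z) \<partial>lebesgue)
      = (\<integral>\<^sup>+ z. ennreal (C_const r p * f z) \<partial>lebesgue)"
    using C f_nonneg by (simp add: ennreal_mult nn_integral_cmult)
  also have "\<dots> \<le> (\<integral>\<^sup>+ z. ennreal (g z) \<partial>lebesgue)"
    by (intro nn_integral_mono ennreal_leI f_le_g)
  finally have "ereal (C_const r p) * enn2ereal (\<integral>\<^sup>+ z. ennreal (f z) \<partial>lebesgue)
      \<le> enn2ereal (\<integral>\<^sup>+ z. ennreal (g z) \<partial>lebesgue)"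
    using C by (simp add: less_eq_ennreal.rep_eq times_ennreal.rep_eq enn2ereal_ennreal)
  then show ?thesis
    using f_nonneg g_nonneg
    by (simp add: energy_def f_def[symmetric] g_def[symmetric] ennreal_neg zero_ennreal.rep_eq)
qed

end
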